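(* Let $B$ be a complete atomic Boolean algebra and let $\varphi$ be a modal formula whose atomic propositions are parameter-free set-theoretic sentences. Then either $M_B,a\models\varphi$ for every $a\in B\setminus\{0,1\}$, or $M_B,a\not\models\varphi$ for every $a\in B\setminus\{0,1\}$.
   Context: Boolean-valued models. For a complete Boolean algebra $B$ (bottom $0$, top $1$, complement $a^\ast$, $a\to b:=a^\ast\vee b$), define by transfinite recursion $V^{(B)}_\alpha=\{x: x$ is a function, $\mathrm{ran}(x)\subseteq B$, and $\mathrm{dom}(x)\subseteq V^{(B)}_\xi$ for some $\xi<\alpha\}$ and $V^{(B)}=\bigcup_\alpha V^{(B)}_\alpha$. Let $L_\in$ be the first-order language of set theory and $L_B$ its expansion by a constant symbol for each element of $V^{(B)}$. The Boolean value $\llbracket\cdot\rrbracket_B$ of $L_B$-sentences is defined recursively by $\llbracket u\in v\rrbracket_B=\bigvee_{x\in\mathrm{dom}(v)}(v(x)\wedge\llbracket x=u\rrbracket_B)$, $\llbracket u=v\rrbracket_B=\bigwedge_{x\in\mathrm{dom}(u)}(u(x)\to\llbracket x\in v\rrbracket_B)\wedge\bigwedge_{y\in\mathrm{dom}(v)}(v(y)\to\llbracket y\in u\rrbracket_B)$, the Boolean operations for the connectives, and meets (resp. joins) over $V^{(B)}$ for $\forall$ (resp. $\exists$). $B$ is atomic if every element is the join of a set of atoms (minimal nonzero elements). Internal modal semantics. $\mathsf{Sent}_{\in}$ is the (countable) set of parameter-free $L_\in$-sentences; its elements are used as the atomic propositions of the propositional modal language with $\neg,\wedge,\vee,\to,\Box,\Diamond$.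 On $B$ let $aRb\iff a\wedge b\neq 0$. Satisfaction in $M_B=\langle B,R,\llbracket\cdot\rrbracket_B\rangle$ at states $b\in B$: $M_B,b\models p$ iff $b\le\llbracket p\rrbracket_B$ for $p\in\mathsf{Sent}_{\in}$; modal-language Boolean connectives are interpreted classically at each state; $M_B,b\models\Box\varphi$ iff $M_B,a\models\varphi$ for all $a\in B$ with $bRa$; $M_B,b\models\Diamond\varphi$ iff $M_B,a\models\varphi$ for some $a\in B$ with $bRa$. *)

theory Defs
  imports Main "HOL-Library.Multiset"
begin

text \<open>
  The universe \<open>V\<close> of sets, with \<open>elts x\<close> the class of members of \<open>x\<close>. Separation, replacement
  and foundation are stated for arbitrary HOL predicates, functions and classes. The axiom of
  choice is not listed because it follows: a choice function on \<open>elts x\<close> is given by Hilbert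
  choice, and its image is a set by replacement.
\<close>

class zfc_universe =
  fixes elts :: "'a \<Rightarrow> 'a set"
  assumes extensionality: "elts x = elts y \<Longrightarrow> x = y"
    and pairing: "\<exists>z. elts z = {x, y}"
    and union: "\<exists>z. elts z = \<Union> (elts ` elts x)"
    and powerset: "\<exists>z. elts z = {y. elts y \<subseteq> elts x}"
    and separation: "\<exists>z. elts z = {y \<in> elts x. P y}"
    and replacement: "\<exists>z. elts z = f ` elts x"
    and infinity: "\<exists>z. (\<exists>e \<in> elts z. elts e = {}) \<and>
                       (\<forall>y \<in> elts z. \<exists>s \<in> elts z. elts s = insert y (elts y))"
    and foundation: "wf {(y, x). y \<in> elts x}"

definition Ord :: "'v::zfc_universe \<Rightarrow> bool" where
  "Ord \<alpha> \<longleftrightarrow> (\<forall>\<beta> \<in> elts \<alpha>. elts \<beta> \<subseteq> elts \<alpha>) \<and>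
             (\<forall>\<beta> \<in> elts \<alpha>. \<forall>\<gamma> \<in> elts \<beta>. elts \<gamma> \<subseteq> elts \<beta>)"

definition upair :: "'v::zfc_universe \<Rightarrow> 'v \<Rightarrow> 'v" where
  "upair x y = (THE z. elts z = {x, y})"

definition opair :: "'v::zfc_universe \<Rightarrow> 'v \<Rightarrow> 'v" where
  "opair x y = upair (upair x x) (upair x y)"

definition vdom :: "'v::zfc_universe \<Rightarrow> 'v set" where
  "vdom f = {x. \<exists>y. opair x y \<in> elts f}"

definition vran :: "'v::zfc_universe \<Rightarrow> 'v set" where
  "vran f = {y. \<exists>x. opair x y \<in> elts f}"

definition vfun :: "'v::zfc_universe \<Rightarrow> bool" where
  "vfun f \<longleftrightarrow> (\<forall>p \<in> elts f. \<exists>x y. p = opair x y) \<and>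
             (\<forall>x y y'. opair x y \<in> elts f \<longrightarrow> opair x y' \<in> elts f \<longrightarrow> y = y')"

lemma elts_upair: "elts (upair x y) = {x, y}"
proof -
  obtain z where "elts z = {x, y}"
    using pairing by blast
  then show ?thesis
    unfolding upair_def by (metis (mono_tags, lifting) extensionality theI')
qed

lemma vdom_trancl:
  assumes "x \<in> vdom f"
  shows "(x, f) \<in> {(y, x). y \<in> elts x}\<^sup>+"
proof -
  obtain y where "opair x y \<in> elts f"
    using assms by (auto simp: vdom_def)
  moreover have "x \<in> elts (upair x x)" "upair x x \<in> elts (opair x y)"
    by (simp_all add: opair_def elts_upair)
  ultimately show ?thesis
    by (meson CollectI case_prodI trancl.r_into_trancl trancl_trans)
qed

lemma vdom_mult:
  assumes "x \<in> vdom v"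
  shows "({#x, w#}, {#w, v#}) \<in> mult ({(y, x). y \<in> elts x}\<^sup>+)"
    and "({#x, w#}, {#v, w#}) \<in> mult ({(y, x). y \<in> elts x}\<^sup>+)"
  using one_step_implies_mult[of "{#v#}" "{#x#}" "{(y, x). y \<in> elts x}\<^sup>+" "{#w#}"]
    vdom_trancl[OF assms] by (simp_all add: add_mset_commute)

text \<open>
  The algebra \<open>B\<close> is a type \<open>'b\<close>, realised as a set of \<open>V\<close> by an injection \<open>c\<close> onto the members of
  some set; \<open>c\<close> is a parameter of everything that depends on \<open>B\<close> as a set. The sort
  \<open>{boolean_algebra, complete_lattice}\<close> is used because the class \<open>complete_boolean_algebra\<close> of the
  library demands complete distributivity in addition.
\<close>

function VB_level :: "('b::{boolean_algebra, complete_lattice} \<Rightarrow> 'v::zfc_universe) \<Rightarrow> 'v \<Rightarrow> 'v set"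
  where
  "VB_level c \<alpha> =
     {x. vfun x \<and> vran x \<subseteq> range c \<and> (\<exists>\<xi> \<in> elts \<alpha>. vdom x \<subseteq> VB_level c \<xi>)}"
  by pat_completeness auto
termination
  by (relation "inv_image {(y, x). y \<in> elts x} snd") (auto intro: foundation)

declare VB_level.simps [simp del]

definition VB :: "('b::{boolean_algebra, complete_lattice} \<Rightarrow> 'v::zfc_universe) \<Rightarrow> 'v set" where
  "VB c = (\<Union>\<alpha> \<in> {\<alpha>. Ord \<alpha>}. VB_level c \<alpha>)"

text \<open>\<open>bapp c f x\<close> is the value \<open>f(x)\<close>, read back as an element of \<open>B\<close>.\<close>

definition bapp :: "('b::{boolean_algebra, complete_lattice} \<Rightarrow> 'v::zfc_universe) \<Rightarrow> 'v \<Rightarrow> 'v \<Rightarrow> 'b"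
  where "bapp c f x = (THE b. opair x (c b) \<in> elts f)"

definition bimp :: "'b::boolean_algebra \<Rightarrow> 'b \<Rightarrow> 'b" where
  "bimp a b = sup (- a) b"

function bmem :: "('b::{boolean_algebra, complete_lattice} \<Rightarrow> 'v::zfc_universe) \<Rightarrow> 'v \<Rightarrow> 'v \<Rightarrow> 'b"
  and beq :: "('b \<Rightarrow> 'v) \<Rightarrow> 'v \<Rightarrow> 'v \<Rightarrow> 'b" where
  "bmem c u v = (SUP x \<in> vdom v. inf (bapp c v x) (beq c x u))"
| "beq c u v = inf (INF x \<in> vdom u. bimp (bapp c u x) (bmem c x v))
                   (INF y \<in> vdom v. bimp (bapp c v y) (bmem c y u))"
  by pat_completeness auto
termination
  by (relation "inv_image (mult ({(y, x). y \<in> elts x}\<^sup>+))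
        (\<lambda>s. case s of Inl (c, u, v) \<Rightarrow> {#u, v#} | Inr (c, u, v) \<Rightarrow> {#u, v#})")
    (auto intro: wf_mult wf_trancl foundation vdom_mult)

declare bmem.simps [simp del] beq.simps [simp del]

text \<open>
  Formulas of the language of set theory with constant symbols from \<open>'k\<close>. The formulas of
  \<open>L\<^sub>\<in>\<close> are those in which no constant occurs.
\<close>

datatype (params_trm: 'k) trm = Var nat | Cst 'k

datatype (params: 'k) fm =
    Mem "'k trm" "'k trm"
  | Eq "'k trm" "'k trm"
  | Neg "'k fm"
  | And "'k fm" "'k fm"
  | Or "'k fm" "'k fm"
  | Imp "'k fm" "'k fm"
  | All nat "'k fm"
  | Ex nat "'k fm"

primrec fv_trm :: "'k trm \<Rightarrow> nat set" where
  "fv_trm (Var n) = {n}"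
| "fv_trm (Cst k) = {}"

primrec fv :: "'k fm \<Rightarrow> nat set" where
  "fv (Mem s t) = fv_trm s \<union> fv_trm t"
| "fv (Eq s t) = fv_trm s \<union> fv_trm t"
| "fv (Neg p) = fv p"
| "fv (And p q) = fv p \<union> fv q"
| "fv (Or p q) = fv p \<union> fv q"
| "fv (Imp p q) = fv p \<union> fv q"
| "fv (All n p) = fv p - {n}"
| "fv (Ex n p) = fv p - {n}"

text \<open>\<open>subst n k p\<close> replaces the free occurrences of variable \<open>n\<close> in \<open>p\<close> by the constant \<open>k\<close>.\<close>

primrec subst_trm :: "nat \<Rightarrow> 'k \<Rightarrow> 'k trm \<Rightarrow> 'k trm" where
  "subst_trm n k (Var m) = (if m = n then Cst k else Var m)"
| "subst_trm n k (Cst l) = Cst l"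

primrec subst :: "nat \<Rightarrow> 'k \<Rightarrow> 'k fm \<Rightarrow> 'k fm" where
  "subst n k (Mem s t) = Mem (subst_trm n k s) (subst_trm n k t)"
| "subst n k (Eq s t) = Eq (subst_trm n k s) (subst_trm n k t)"
| "subst n k (Neg p) = Neg (subst n k p)"
| "subst n k (And p q) = And (subst n k p) (subst n k q)"
| "subst n k (Or p q) = Or (subst n k p) (subst n k q)"
| "subst n k (Imp p q) = Imp (subst n k p) (subst n k q)"
| "subst n k (All m p) = (if m = n then All m p else All m (subst n k p))"
| "subst n k (Ex m p) = (if m = n then Ex m p else Ex m (subst n k p))"

lemma size_subst_trm [simp]: "size (subst_trm n k t) = size t"
  by (cases t) simp_all

lemma size_subst [simp]: "size (subst n k p) = size p"
  by (induction p) simp_all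

definition Sent :: "'k fm set" where
  "Sent = {p. fv p = {} \<and> params p = {}}"

text \<open>
  Boolean values are meant for sentences whose constants lie in \<open>VB c\<close>. Such sentences never
  lead to the value of \<open>denot\<close> on a variable, which is left unspecified.
\<close>

primrec denot :: "'k trm \<Rightarrow> 'k" where
  "denot (Cst k) = k"
| "denot (Var n) = undefined"

function bval :: "('b::{boolean_algebra, complete_lattice} \<Rightarrow> 'v::zfc_universe) \<Rightarrow> 'v fm \<Rightarrow> 'b" where
  "bval c (Mem s t) = bmem c (denot s) (denot t)"
| "bval c (Eq s t) = beq c (denot s) (denot t)"
| "bval c (Neg p) = - bval c p"
| "bval c (And p q) = inf (bval c p) (bval c q)"
| "bval c (Or p q) = sup (bval c p) (bval c q)"
| "bval c (Imp p q) = bimp (bval c p) (bval c q)"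
| "bval c (All n p) = (INF u \<in> VB c. bval c (subst n u p))"
| "bval c (Ex n p) = (SUP u \<in> VB c. bval c (subst n u p))"
  by pat_completeness auto
termination
  by (relation "measure (\<lambda>(c, p). size p)") auto

definition atom :: "'b::{boolean_algebra, complete_lattice} \<Rightarrow> bool" where
  "atom a \<longleftrightarrow> a \<noteq> bot \<and> (\<forall>b. b \<noteq> bot \<longrightarrow> b \<le> a \<longrightarrow> b = a)"

datatype (atoms: 'p) modal =
    Atm 'p
  | MNeg "'p modal"
  | MAnd "'p modal" "'p modal"
  | MOr "'p modal" "'p modal"
  | MImp "'p modal" "'p modal"
  | Box "'p modal"
  | Dia "'p modal"

definition acc :: "'b::{boolean_algebra, complete_lattice} \<Rightarrow> 'b \<Rightarrow> bool" where
  "acc a b \<longleftrightarrow> inf a b \<noteq> bot"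

text \<open>\<open>sat c b \<phi>\<close> is satisfaction of \<open>\<phi>\<close> at the state \<open>b\<close>; every element of \<open>B\<close>, including \<open>bot\<close>, is
  a state.\<close>

primrec sat :: "('b::{boolean_algebra, complete_lattice} \<Rightarrow> 'v::zfc_universe) \<Rightarrow> 'b \<Rightarrow> 'v fm modal \<Rightarrow> bool"
  where
  "sat c b (Atm p) \<longleftrightarrow> b \<le> bval c p"
| "sat c b (MNeg \<phi>) \<longleftrightarrow> \<not> sat c b \<phi>"
| "sat c b (MAnd \<phi> \<psi>) \<longleftrightarrow> sat c b \<phi> \<and> sat c b \<psi>"
| "sat c b (MOr \<phi> \<psi>) \<longleftrightarrow> sat c b \<phi> \<or> sat c b \<psi>"
| "sat c b (MImp \<phi> \<psi>) \<longleftrightarrow> (sat c b \<phi> \<longrightarrow> sat c b \<psi>)"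
| "sat c b (Box \<phi>) \<longleftrightarrow> (\<forall>a. acc b a \<longrightarrow> sat c a \<phi>)"
| "sat c b (Dia \<phi>) \<longleftrightarrow> (\<exists>a. acc b a \<and> sat c a \<phi>)"

end

theory Submission
  imports Defs "HOL-Combinatorics.Transposition"
begin

text \<open>
  An automorphism of \<open>B\<close> acts on \<open>V\<^sup>(\<^sup>B\<^sup>)\<close> and thereby fixes the Boolean value of every
  parameter-free sentence. In an atomic algebra any two atoms are exchanged by an automorphism, so
  a fixed element lies above all atoms or above none: the value is \<open>0\<close> or \<open>1\<close>. Atomic
  propositions therefore do not distinguish nonzero states. Since every nonzero state sees itself
  and sees only nonzero states, no modal formula distinguishes them either.
\<close>

section \<open>Involutive automorphisms and atoms\<close>

text \<open>A monotone involution is its own inverse, hence an order automorphism; preservation of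
  all joins, meets and complements follows from the order alone.\<close>

locale order_involution =
  fixes \<pi> :: "'b::{boolean_algebra, complete_lattice} \<Rightarrow> 'b"
  assumes involution [simp]: "\<pi> (\<pi> x) = x"
    and mono: "x \<le> y \<Longrightarrow> \<pi> x \<le> \<pi> y"
begin

lemma le_iff: "\<pi> x \<le> y \<longleftrightarrow> x \<le> \<pi> y"
  using mono[of x "\<pi> y"] mono[of "\<pi> x" y] by auto

lemma Sup_image: "\<pi> (Sup A) = Sup (\<pi> ` A)"
proof (rule antisym)
  have "Sup A \<le> \<pi> (Sup (\<pi> ` A))"
    by (rule Sup_least) (simp add: SUP_upper flip: le_iff)
  then show "\<pi> (Sup A) \<le> Sup (\<pi> ` A)"
    by (simp add: le_iff)
  show "Sup (\<pi> ` A) \<le> \<pi> (Sup A)"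
    by (auto intro!: SUP_least mono Sup_upper)
qed

lemma Inf_image: "\<pi> (Inf A) = Inf (\<pi> ` A)"
proof (rule antisym)
  show "\<pi> (Inf A) \<le> Inf (\<pi> ` A)"
    by (auto intro!: INF_greatest mono Inf_lower)
  have "\<pi> (Inf (\<pi> ` A)) \<le> Inf A"
    by (rule Inf_greatest) (simp add: le_iff INF_lower)
  then show "Inf (\<pi> ` A) \<le> \<pi> (Inf A)"
    by (simp add: le_iff)
qed

lemma sup_image: "\<pi> (sup x y) = sup (\<pi> x) (\<pi> y)"
  using Sup_image[of "{x, y}"] by simp

lemma inf_image: "\<pi> (inf x y) = inf (\<pi> x) (\<pi> y)"
  using Inf_image[of "{x, y}"] by simp

lemma compl_image: "\<pi> (- x) = - \<pi> x"
proof (rule compl_unique[symmetric])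
  show "inf (\<pi> x) (\<pi> (- x)) = bot"
    \<comment> \<open>The empty join shows that \<open>\<pi>\<close> fixes \<open>bot\<close>; the
      empty meet below does the same for \<open>top\<close>.\<close>
    using Sup_image[of "{}"] by (simp flip: inf_image)
  show "sup (\<pi> x) (\<pi> (- x)) = top"
    using Inf_image[of "{}"] by (simp flip: sup_image)
qed

lemma bimp_image: "\<pi> (bimp x y) = bimp (\<pi> x) (\<pi> y)"
  by (simp add: bimp_def sup_image compl_image)

end

section \<open>Atoms and the automorphism exchanging two of them\<close>

lemma atom_le_Sup:
  fixes a :: "'b::{boolean_algebra, complete_lattice}"
  assumes "atom a" "a \<le> Sup S"
  shows "\<exists>s \<in> S. a \<le> s"
proof (rule ccontr)
  assume not_le: "\<not> (\<exists>s \<in> S. a \<le> s)"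
  \<comment> \<open>An atom is disjoint from whatever it is not below. Bounding \<open>S\<close> by
    \<open>- a\<close> then takes the place of infinite distributivity.\<close>
  have "s \<le> - a" if "s \<in> S" for s
  proof -
    have "inf a s \<noteq> a"
      using not_le that by (auto simp: inf.absorb_iff1)
    then have "inf s a = bot"
      using \<open>atom a\<close> unfolding atom_def by (metis inf.commute inf_le1)
    then show ?thesis
      by (simp add: inf_shunt)
  qed
  then have "a \<le> - a"
    using \<open>a \<le> Sup S\<close> by (meson Sup_least order_trans)
  then show False
    using \<open>atom a\<close> by (metis atom_def inf.absorb1 inf_compl_bot)
qed

lemma atom_le_atom:
  assumes "atom a" "atom b" "a \<le> b"
  shows "a = b"
  using assms unfolding atom_def by blast

text \<open>For atoms \<open>s\<close> and \<open>t\<close>, the atoms joined here are exactly the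
  images under \<open>transpose s t\<close> of those below \<open>b\<close>, as the transposition is
  its own inverse.\<close>

definition swap_atoms :: "'b::{boolean_algebra, complete_lattice} \<Rightarrow> 'b \<Rightarrow> 'b \<Rightarrow> 'b" where
  "swap_atoms s t b = Sup {a. atom a \<and> transpose s t a \<le> b}"

lemma atom_le_swap_atoms:
  assumes "atom a"
  shows "a \<le> swap_atoms s t b \<longleftrightarrow> transpose s t a \<le> b"
  using assms unfolding swap_atoms_def
  by (auto dest!: atom_le_Sup[OF assms] dest: atom_le_atom[OF assms] intro: Sup_upper)

context
  assumes atomic: "\<And>b::'b::{boolean_algebra, complete_lattice}. \<exists>S. (\<forall>s \<in> S. atom s) \<and> b = Sup S"
begin

text \<open>Reduces comparisons in an atomic algebra to atoms, on which \<open>swap_atoms\<close> is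
  just a transposition.\<close>

lemma le_if_atoms_le:
  assumes below: "\<And>a. atom a \<Longrightarrow> a \<le> x \<Longrightarrow> a \<le> y"
  shows "(x::'b) \<le> y"
proof -
  obtain S where "\<forall>s \<in> S. atom s" "x = Sup S"
    using atomic by blast
  then show "x \<le> y"
    using below by (auto intro: Sup_least Sup_upper)
qed

lemma order_involution_swap_atoms:
  assumes "atom s" "atom (t::'b)"
  shows "order_involution (swap_atoms s t)"
proof
  have transpose: "atom (transpose s t a)" if "atom a" for a
    using assms that by (simp add: transpose_def)
  show "swap_atoms s t (swap_atoms s t x) = x" for x
    by (rule antisym; rule le_if_atoms_le)
      (simp_all add: atom_le_swap_atoms transpose)
  show "swap_atoms s t x \<le> swap_atoms s t y" if "x \<le> y" for x y
    unfolding swap_atoms_def using that by (intro Sup_subset_mono) (auto dest: order_trans)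
qed

text \<open>If some atom \<open>s\<close> is below \<open>e\<close>, exchanging \<open>s\<close>
  with any atom \<open>t\<close> puts \<open>t\<close> below \<open>e\<close> as well, and having
  all atoms below forces \<open>top\<close>. Without such an \<open>s\<close> only
  \<open>bot\<close> remains.\<close>

lemma swap_invariant_cases:
  assumes "\<And>s t. atom s \<Longrightarrow> atom t \<Longrightarrow> swap_atoms s t e = (e::'b)"
  shows "e = bot \<or> e = top"
proof (cases "\<exists>s. atom s \<and> s \<le> e")
  case True
  then obtain s where "atom s" "s \<le> e"
    by blast
  have "t \<le> e" if "atom t" for t
    using atom_le_swap_atoms[OF that, of s t e] assms[OF \<open>atom s\<close> that] \<open>s \<le> e\<close> by simp
  then have "top \<le> e"
    by (rule le_if_atoms_le) auto
  then show ?thesis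
    by (simp add: top_unique)
next
  case False
  have "e \<le> bot"
    by (rule le_if_atoms_le) (use False in blast)
  then show ?thesis
    by (simp add: bot_unique)
qed

end

section \<open>The action on names\<close>

lemma opair_eq_iff [simp]: "opair x y = opair x' y' \<longleftrightarrow> x = x' \<and> y = y'"
proof
  assume "opair x y = opair x' y'"
  then have "elts (opair x y) = elts (opair x' y')"
    by simp
  moreover have "upair a b = upair a' b' \<longleftrightarrow> {a, b} = {a', b'}" for a b a' b' :: 'a
    by (metis elts_upair extensionality)
  ultimately show "x = x' \<and> y = y'"
    by (auto simp: opair_def elts_upair doubleton_eq_iff)
qed simp

lemma vdomI: "opair x y \<in> elts f \<Longrightarrow> x \<in> vdom f"
  by (auto simp: vdom_def)

text \<open>The automorphism acts hereditarily, on arguments and on values. Ranging over the pairs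
  coded in \<open>x\<close> tells the termination proof that each recursive call is at a member of
  \<open>vdom x\<close>.\<close>

function lift_name ::
  "('b \<Rightarrow> 'v::zfc_universe) \<Rightarrow> ('b \<Rightarrow> 'b) \<Rightarrow> 'v \<Rightarrow> 'v" where
  "lift_name c \<pi> x = (THE z. elts z =
     (\<lambda>(y, b). opair (lift_name c \<pi> y) (c (\<pi> b))) ` {(y, b). opair y (c b) \<in> elts x})"
  by pat_completeness auto
termination
  by (relation "inv_image ({(y, x). y \<in> elts x}\<^sup>+) (\<lambda>(c, \<pi>, x). x)")
    (auto intro: wf_trancl foundation vdom_trancl vdomI)

declare lift_name.simps [simp del]

section \<open>Stages of the universe of names\<close>

lemma VB_level_iff:
  "x \<in> VB_level c \<alpha> \<longleftrightarrow>
     vfun x \<and> vran x \<subseteq> range c \<and> (\<exists>\<xi> \<in> elts \<alpha>. vdom x \<subseteq> VB_level c \<xi>)"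
  by (subst VB_level.simps) simp

lemma Ord_elts: "Ord \<alpha> \<Longrightarrow> \<xi> \<in> elts \<alpha> \<Longrightarrow> Ord \<xi>"
  unfolding Ord_def by blast

lemma VB_vfun: "x \<in> VB c \<Longrightarrow> vfun x"
  by (auto simp: VB_def VB_level_iff)

lemma VB_vdom: "x \<in> VB c \<Longrightarrow> y \<in> vdom x \<Longrightarrow> y \<in> VB c"
  unfolding VB_def by (auto simp: VB_level_iff[of x] dest: Ord_elts)

lemma VB_vdomE:
  assumes "x \<in> VB c" "y \<in> vdom x"
  obtains b where "opair y (c b) \<in> elts x"
  using assms by (auto simp: VB_def VB_level_iff[of x] vdom_def vran_def)

section \<open>Substitution and renaming of constants\<close>

lemma subst_map_fm: "subst n (f k) (map_fm f p) = map_fm f (subst n k p)"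
proof -
  have "subst_trm n (f k) (map_trm f t) = map_trm f (subst_trm n k t)" for t
    by (cases t) simp_all
  then show ?thesis
    by (induction p) simp_all
qed

lemma fv_subst:
  fixes p :: "'k fm"
  shows "fv (subst n k p) = fv p - {n}"
proof -
  have "fv_trm (subst_trm n k t) = fv_trm t - {n}" for t :: "'k trm"
    by (cases t) simp_all
  then show ?thesis
    by (induction p) auto
qed

lemma params_subst: "params (subst n k p) \<subseteq> insert k (params p)"
proof -
  have "params_trm (subst_trm n k t) \<subseteq> insert k (params_trm t)" for t
    by (cases t) simp_all
  then show ?thesis
    by (induction p) (simp_all, blast+)
qed

lemma denot_map_trm: "fv_trm t = {} \<Longrightarrow> denot (map_trm f t) = f (denot t)"
  by (cases t) simp_all

lemma denot_in_params: "fv_trm t = {} \<Longrightarrow> denot t \<in> params_trm t"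
  by (cases t) simp_all

text \<open>The mutual induction behind \<open>bmem\<close> and \<open>beq\<close>, with the coding
  \<open>c\<close> held fixed so that it matches statements about two names only.\<close>

lemma bmem_beq_induct [case_names 1 2]:
  assumes "\<And>u v. (\<And>x. x \<in> vdom v \<Longrightarrow> Q x u) \<Longrightarrow> P u v"
    and "\<And>u v. (\<And>x. x \<in> vdom u \<Longrightarrow> P x v) \<Longrightarrow> (\<And>y. y \<in> vdom v \<Longrightarrow> P y u) \<Longrightarrow> Q u v"
  shows "P u v" and "Q u v"
proof -
  show "P u v"
    by (rule bmem_beq.induct(1)[where P = "\<lambda>_. P" and Q = "\<lambda>_. Q"]) (use assms in blast)+
  show "Q u v"
    by (rule bmem_beq.induct(2)[where P = "\<lambda>_. P" and Q = "\<lambda>_. Q"]) (use assms in blast)+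
qed

locale name_action = order_involution \<pi>
  for \<pi> :: "'b::{boolean_algebra, complete_lattice} \<Rightarrow> 'b" +
  fixes c :: "'b \<Rightarrow> 'v::zfc_universe"
  assumes inj_c: "inj c"
begin

abbreviation lift :: "'v \<Rightarrow> 'v" where
  "lift \<equiv> lift_name c \<pi>"

lemma c_eq_iff [simp]: "c a = c b \<longleftrightarrow> a = b"
  using inj_c by (auto dest: injD)

text \<open>The definite description in \<open>lift_name\<close> denotes because the image is a set:
  separation collects the coded pairs of \<open>x\<close>, and replacement maps them after
  decoding.\<close>

lemma elts_lift:
  "elts (lift x) = {p. \<exists>y b. p = opair (lift y) (c (\<pi> b)) \<and> opair y (c b) \<in> elts x}"
proof -
  let ?f = "\<lambda>(y, b). opair (lift y) (c (\<pi> b))"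
  let ?A = "{(y, b). opair y (c b) \<in> elts x}"
  let ?code = "\<lambda>(y, b). opair y (c b)"
  have inj: "inj ?code"
    by (auto simp: inj_def)
  obtain d where d: "elts d = {p \<in> elts x. p \<in> range ?code}"
    using separation[of x "\<lambda>p. p \<in> range ?code"] by blast
  have "elts d = ?code ` ?A"
    unfolding d by force
  then have image: "?f ` ?A = (\<lambda>p. ?f (inv ?code p)) ` elts d"
    by (simp add: image_image inv_f_f[OF inj])
  obtain z where z: "elts z = ?f ` ?A"
    unfolding image using replacement[of "\<lambda>p. ?f (inv ?code p)" d] by blast
  then have "elts (lift x) = ?f ` ?A"
    by (subst lift_name.simps, rule theI2[of _ z]) (auto intro: extensionality)
  then show ?thesis
    by auto
qed

text \<open>Both claims go through one induction: for \<open>lift x\<close> to be a function,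
  \<open>lift\<close> must be injective on \<open>vdom x\<close>, and that follows from involutivity
  at a lower level.\<close>

lemma VB_level_lift:
  assumes "x \<in> VB_level c \<alpha>"
  shows "lift x \<in> VB_level c \<alpha>" and "lift (lift x) = x"
proof -
  have "\<forall>x \<in> VB_level c \<alpha>. lift x \<in> VB_level c \<alpha> \<and> lift (lift x) = x"
  proof (induction \<alpha> rule: wf_induct_rule[OF foundation])
    case (1 \<alpha>)
    show ?case
    proof
      fix x
      assume "x \<in> VB_level c \<alpha>"
      then obtain \<xi> where x: "vfun x" "vran x \<subseteq> range c" "\<xi> \<in> elts \<alpha>" "vdom x \<subseteq> VB_level c \<xi>"
        by (auto simp: VB_level_iff)
      have IH: "lift y \<in> VB_level c \<xi>" "lift (lift y) = y" if "y \<in> vdom x" for y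
        using 1[of \<xi>] x(3,4) that by auto
      have "vfun (lift x)"
        unfolding vfun_def
      proof (intro conjI allI impI ballI)
        show "\<exists>y z. p = opair y z" if "p \<in> elts (lift x)" for p
          using that by (auto simp: elts_lift)
        show "z = z'" if pairs: "opair y z \<in> elts (lift x)" "opair y z' \<in> elts (lift x)" for y z z'
        proof -
          obtain w b where w: "y = lift w" "z = c (\<pi> b)" "opair w (c b) \<in> elts x"
            using pairs(1) by (auto simp: elts_lift)
          obtain w' b' where w': "y = lift w'" "z' = c (\<pi> b')" "opair w' (c b') \<in> elts x"
            using pairs(2) by (auto simp: elts_lift)
          from w w' have "w = w'"
            by (metis IH(2) vdomI)
          then have "c b = c b'"
            using w w' x(1) unfolding vfun_def by blast
          then show ?thesis
            using w w' by simp
        qed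
      qed
      moreover have "vran (lift x) \<subseteq> range c"
        by (auto simp: vran_def elts_lift)
      moreover have "vdom (lift x) \<subseteq> VB_level c \<xi>"
        using IH(1) by (auto simp: vdom_def elts_lift)
      ultimately have "lift x \<in> VB_level c \<alpha>"
        using x(3) by (auto simp: VB_level_iff)
      moreover have "lift (lift x) = x"
      proof (rule extensionality, rule set_eqI)
        fix p
        have "p \<in> elts (lift (lift x)) \<longleftrightarrow>
          (\<exists>y b. p = opair (lift (lift y)) (c b) \<and> opair y (c b) \<in> elts x)"
          \<comment> \<open>For the converse direction the witnesses are \<open>lift y\<close> and
            \<open>\<pi> b\<close>; applying \<open>\<pi>\<close> twice restores
            \<open>b\<close>.\<close>
          unfolding elts_lift[of "lift x"] unfolding elts_lift by (auto, metis involution)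
        also have "\<dots> \<longleftrightarrow> (\<exists>y b. p = opair y (c b) \<and> opair y (c b) \<in> elts x)"
          using IH(2) by (metis vdomI)
        also have "\<dots> \<longleftrightarrow> p \<in> elts x"
        proof
          assume "p \<in> elts x"
          moreover from this obtain y z where "p = opair y z"
            using x(1) unfolding vfun_def by blast
          moreover from calculation have "z \<in> range c"
            using x(2) by (auto simp: vran_def)
          ultimately show "\<exists>y b. p = opair y (c b) \<and> opair y (c b) \<in> elts x"
            by auto
        qed auto
        finally show "p \<in> elts (lift (lift x)) \<longleftrightarrow> p \<in> elts x" .
      qed
      ultimately show "lift x \<in> VB_level c \<alpha> \<and> lift (lift x) = x"
        by blast
    qed
  qed
  then show "lift x \<in> VB_level c \<alpha>" and "lift (lift x) = x"
    using assms by auto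
qed

lemma VB_lift: "x \<in> VB c \<Longrightarrow> lift x \<in> VB c"
  and lift_lift: "x \<in> VB c \<Longrightarrow> lift (lift x) = x"
  by (auto simp: VB_def VB_level_lift)

text \<open>Allows the meets and joins that interpret quantifiers to be reindexed along
  \<open>lift\<close>.\<close>

lemma lift_image_VB: "lift ` VB c = VB c"
  by (force simp: image_iff lift_lift intro: VB_lift lift_lift[symmetric])

text \<open>\<open>lift\<close> drops pairs whose second component is no code; names in
  \<open>VB c\<close> have none.\<close>

lemma vdom_lift:
  assumes "x \<in> VB c"
  shows "vdom (lift x) = lift ` vdom x"
proof (rule set_eqI)
  fix z
  have "z \<in> vdom (lift x) \<longleftrightarrow> (\<exists>y b. z = lift y \<and> opair y (c b) \<in> elts x)"
    by (auto simp: vdom_def elts_lift)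
  also have "\<dots> \<longleftrightarrow> z \<in> lift ` vdom x"
    by (blast intro: vdomI elim: VB_vdomE[OF assms])
  finally show "z \<in> vdom (lift x) \<longleftrightarrow> z \<in> lift ` vdom x" .
qed

lemma bapp_eq:
  assumes "x \<in> VB c" "opair y (c b) \<in> elts x"
  shows "bapp c x y = b"
  unfolding bapp_def
proof (rule the_equality)
  show "b' = b" if "opair y (c b') \<in> elts x" for b'
    using VB_vfun[OF assms(1)] assms(2) that unfolding vfun_def by (metis c_eq_iff)
qed fact

lemma bapp_lift:
  assumes "x \<in> VB c" "y \<in> vdom x"
  shows "bapp c (lift x) (lift y) = \<pi> (bapp c x y)"
proof -
  obtain b where b: "opair y (c b) \<in> elts x"
    using VB_vdomE[OF assms] .
  then have "opair (lift y) (c (\<pi> b)) \<in> elts (lift x)"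
    unfolding elts_lift by blast
  then show ?thesis
    using assms(1) b by (simp add: bapp_eq VB_lift)
qed

text \<open>Reindexing the domains along \<open>lift\<close> turns each join or meet into one over
  the original names, through which \<open>\<pi>\<close> passes.\<close>

lemma bmem_lift: "u \<in> VB c \<Longrightarrow> v \<in> VB c \<Longrightarrow> bmem c (lift u) (lift v) = \<pi> (bmem c u v)"
  and beq_lift: "u \<in> VB c \<Longrightarrow> v \<in> VB c \<Longrightarrow> beq c (lift u) (lift v) = \<pi> (beq c u v)"
proof (induction u v and u v rule: bmem_beq_induct)
  case (1 u v)
  have "bmem c (lift u) (lift v)
      = (SUP x \<in> vdom v. inf (bapp c (lift v) (lift x)) (beq c (lift x) (lift u)))"
    using 1 by (simp add: bmem.simps[of c "lift u"] vdom_lift image_image)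
  also have "\<dots> = (SUP x \<in> vdom v. \<pi> (inf (bapp c v x) (beq c x u)))"
    using 1 by (intro SUP_cong) (simp_all add: bapp_lift inf_image VB_vdom)
  also have "\<dots> = \<pi> (bmem c u v)"
    by (simp add: bmem.simps[of c u] Sup_image image_image)
  finally show ?case .
next
  case (2 u v)
  \<comment> \<open>The two meets defining \<open>beq\<close> differ by exchanging the names, so one
    computation serves both.\<close>
  have half: "(INF y \<in> vdom (lift w). bimp (bapp c (lift w) y) (bmem c y (lift w')))
      = \<pi> (INF y \<in> vdom w. bimp (bapp c w y) (bmem c y w'))"
    if "w \<in> VB c" "\<And>y. y \<in> vdom w \<Longrightarrow> bmem c (lift y) (lift w') = \<pi> (bmem c y w')" for w w'
    using that
    by (simp add: vdom_lift image_image Inf_image bimp_image bapp_lift cong: image_cong)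
  show ?case
    unfolding beq.simps[of c "lift u"] beq.simps[of c u] inf_image
    using 2 by (simp add: half VB_vdom)
qed

text \<open>Induction on size, since the quantifier case needs the claim for an instance
  \<open>subst n u q\<close>, which need not be a subformula but has the size of
  \<open>q\<close>.\<close>

lemma bval_map_lift:
  "fv p = {} \<Longrightarrow> params p \<subseteq> VB c \<Longrightarrow> bval c (map_fm lift p) = \<pi> (bval c p)"
proof (induction "size p" arbitrary: p rule: less_induct)
  case less
  have quantifier: "(\<lambda>u. bval c (subst n u (map_fm lift q))) ` VB c
      = \<pi> ` (\<lambda>u. bval c (subst n u q)) ` VB c"
    if "size q < size p" "fv q \<subseteq> {n}" "params q \<subseteq> VB c" for n q
  proof -
    have "bval c (subst n (lift u) (map_fm lift q)) = \<pi> (bval c (subst n u q))"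
      if "u \<in> VB c" for u
      unfolding subst_map_fm
      using less.hyps[of "subst n u q"] \<open>size q < size p\<close> \<open>fv q \<subseteq> {n}\<close> \<open>params q \<subseteq> VB c\<close> that
        params_subst[of n u q] by (auto simp: fv_subst)
    then have "(\<lambda>u. bval c (subst n u (map_fm lift q))) ` lift ` VB c
      = \<pi> ` (\<lambda>u. bval c (subst n u q)) ` VB c"
      unfolding image_image by (rule image_cong[OF refl])
    then show ?thesis
      by (simp only: lift_image_VB)
  qed
  \<comment> \<open>In a closed atomic formula both terms are constants, so their denotations are
    parameters and hence in \<open>VB c\<close>.\<close>
  note params_denot = subsetD[OF _ denot_in_params]
  show ?case
    using less.prems less.hyps quantifier
    by (cases p) (auto simp: denot_map_trm bmem_lift beq_lift params_denot compl_image inf_image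
        sup_image bimp_image Inf_image Sup_image)
qed

text \<open>Renaming constants leaves a formula without constants untouched, so equivariance of
  \<open>bval\<close> becomes invariance.\<close>

lemma bval_Sent_fixed:
  assumes "p \<in> Sent"
  shows "\<pi> (bval c p) = bval c p"
proof -
  have "map_fm lift p = p"
    using assms by (intro fm.map_ident_strong) (auto simp: Sent_def)
  then show ?thesis
    using bval_map_lift[of p] assms by (simp add: Sent_def)
qed

end

section \<open>Modal formulas\<close>

lemma acc_self: "b \<noteq> bot \<Longrightarrow> acc b b"
  by (simp add: acc_def)

lemma acc_nonbot: "acc b a \<Longrightarrow> a \<noteq> bot"
  by (auto simp: acc_def)

text \<open>Reflexivity at nonzero states keeps \<open>Box\<close> from holding vacuously and
  supplies the witness for \<open>Dia\<close>; both thus share the verdict of their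
  argument.\<close>

lemma sat_nonbot_cases:
  assumes "\<And>p. p \<in> atoms \<phi> \<Longrightarrow> bval c p = bot \<or> bval c p = top"
  shows "(\<forall>a. a \<noteq> bot \<longrightarrow> sat c a \<phi>) \<or> (\<forall>a. a \<noteq> bot \<longrightarrow> \<not> sat c a \<phi>)"
  using assms
proof (induction \<phi>)
  case (Atm p)
  then show ?case
    by (auto simp: bot_unique)
next
  case (Box \<phi>)
  then show ?case
    unfolding sat.simps modal.set by (metis acc_self acc_nonbot)
next
  case (Dia \<phi>)
  then show ?case
    unfolding sat.simps modal.set by (metis acc_self acc_nonbot)
qed (simp_all, blast+)

theorem theorem4p5:
  fixes c :: "'b::{boolean_algebra, complete_lattice} \<Rightarrow> 'v::zfc_universe"
    and B :: 'v
    and \<phi> :: "'v fm modal"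
  assumes B_set: "bij_betw c UNIV (elts B)"
    and atomic: "\<forall>b::'b. \<exists>S. (\<forall>s \<in> S. atom s) \<and> b = Sup S"
    and atoms_Sent: "atoms \<phi> \<subseteq> Sent"
  shows "(\<forall>a \<in> UNIV - {bot, top}. sat c a \<phi>) \<or> (\<forall>a \<in> UNIV - {bot, top}. \<not> sat c a \<phi>)"
proof -
  have "bval c p = bot \<or> bval c p = top" if "p \<in> atoms \<phi>" for p
  proof (rule swap_invariant_cases)
    fix s t :: 'b
    assume "atom s" "atom t"
    \<comment> \<open>The action on names is set up afresh for each pair of atoms; the value of
      \<open>p\<close> is fixed under all of them.\<close>
    then interpret order_involution "swap_atoms s t"
      using atomic by (intro order_involution_swap_atoms) auto
    interpret name_action "swap_atoms s t" c
      using B_set by unfold_locales (simp add: bij_betw_def)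
    show "swap_atoms s t (bval c p) = bval c p"
      using that atoms_Sent by (intro bval_Sent_fixed) auto
  qed (use atomic in blast)
  then show ?thesis
    using sat_nonbot_cases[of \<phi> c] by blast
qed

end
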